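(* Let $\mathbf{var}$ be a countably infinite set. Every conjunctive table algebra (with equality) is a projectional semilattice. That is, for every set $G$, if $A \subseteq \mathrm{Tab}(G)$ is the universe of a subalgebra of $\mathbf{Tab}(G)$, then $(A,\Join,\emptyset,\{\langle\rangle\},\mathrm{del}_x,E_{xy},\mathrm{schema})_{x,y\in\mathbf{var}}$ satisfies all the projectional semilattice axioms (PS0)–(PS12), with $\Join$ in the role of $\wedge$, $\emptyset$ in the role of $0$, $\{\langle\rangle\}$ in the role of $1$, $\mathrm{del}_x$ in the role of $c_x$, $E_{xy}$ in the role of $d_{xy}$, and $\mathrm{schema}$ in the role of $\mathrm{dom}$.
   Context: **Tables.** Let $G$ be a set. $\mathfrak{P}_{\mathrm{fin}}(\mathbf{var})$ is the set of finite subsets of $\mathbf{var}$. A table over $G$ is a set $T\subseteq G^X$ of functions $X\to G$, for some $X\in\mathfrak{P}_{\mathrm{fin}}(\mathbf{var})$; $\mathrm{Tab}(G)=\bigcup\{\mathfrak{P}(G^X)\mid X\in\mathfrak{P}_{\mathrm{fin}}(\mathbf{var})\}$ is the set of all tables over $G$ (there is a single empty table $\emptyset$). The function $\mathrm{schema}:\mathrm{Tab}(G)\to\mathfrak{P}(\mathbf{var})$ is given by $\mathrm{schema}(T)=X$ if $\emptyset\neq T\subseteq G^X$, and $\mathrm{schema}(\emptyset)=\mathbf{var}$. $\langle\rangle$ is the unique element of $G^{\emptyset}$ (the empty tuple). - Natural join: for nonempty $T_1\subseteq G^{X_1}$, $T_2\subseteq G^{X_2}$, $T_1\Join T_2=\{t\in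 G^{X_1\cup X_2}\mid t|_{X_1}\in T_1 \text{ and } t|_{X_2}\in T_2\}$; and $\emptyset\Join T=T\Join\emptyset=\emptyset$. - Deletion: for $T\subseteq G^X$, $\mathrm{del}_x(T)=\{t|_{X\setminus\{x\}}\mid t\in T\}$ (so $\mathrm{del}_x(\emptyset)=\emptyset$). - Equality tables: $E_{xy}=\{t\in G^{\{x,y\}}\mid t(x)=t(y)\}$ for $x,y\in\mathbf{var}$ (possibly $x=y$). $\mathbf{Tab}(G)=(\mathrm{Tab}(G),\Join,\emptyset,\{\langle\rangle\},\mathrm{del}_x,E_{xy},\mathrm{schema})_{x,y\in\mathbf{var}}$. A conjunctive table algebra (with equality) with base $G$ is a subalgebra of $\mathbf{Tab}(G)$, i.e. a subset $A\subseteq\mathrm{Tab}(G)$ containing $\emptyset$, $\{\langle\rangle\}$ and all $E_{xy}$, closed under $\Join$ and all $\mathrm{del}_x$, equipped with the restricted operations. **Projectional semilattice.** An algebra $(V,\wedge,0,1,c_x,d_{xy},\mathrm{dom})_{x,y\in\mathbf{var}}$ with a binary operation $\wedge$ on $V$, elements $0,1\in V$, functions $c_x:V\to V$ ($x\in\mathbf{var}$), elements $d_{xy}\in V$ ($x,y\in\mathbf{var}$), and a function $\mathrm{dom}:V\to\mathfrak{P}(\mathbf{var})$, such that for all $u,v\in V$ and $x,y,z\in\mathbf{var}$ (where $u\le v$ means $u=u\wedge v$): - (PS0) $(V,\wedge,0,1)$ is a bounded semilattice ($\wedge$ is associative, commutative and idempotent, with least element $0$ and greatest element $1$) - (PS1)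 $c_x(0)=0$ - (PS2) $u\le c_x(u)$ - (PS3) $c_x(u\wedge c_x(v))=c_x(u)\wedge c_x(v)$ - (PS4) $c_x(c_y(u))=c_y(c_x(u))$ - (PS5) $u\neq 0\Rightarrow(u\neq c_x(u)\Leftrightarrow u\le d_{xx})$ - (PS6) if $x\neq y$ and $x\neq z$, then $d_{yz}=c_x(d_{yx}\wedge d_{xz})$ - (PS7) $x\neq y\Rightarrow d_{xy}\wedge c_x(d_{xy}\wedge u)\le u$ - (PS8) $u\neq0\Rightarrow\mathrm{dom}(u)$ is finite - (PS9) $\mathrm{dom}(u)=\{x\in\mathbf{var}\mid u\le d_{xx}\}$ - (PS10) $\mathrm{dom}(u)=\emptyset\Rightarrow u=1$ - (PS11) $d_{xx}\neq0$ - (PS12) $d_{xy}=d_{yx}$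
   Formalization: The set G is assumed nonempty: for empty G every equality table E_xx is the empty table, so axiom (PS11), d_xx ≠ 0, fails for every conjunctive table algebra with base G. *)

theory Defs
  imports Main "HOL-Library.Countable_Set"
begin

text \<open>
  The set of variables is the universe of a type; the carrier \<open>V\<close> of an algebra is a set, and
  the operations are only constrained on \<open>V\<close>.
\<close>

locale semilattice_signature =
  fixes V :: "'a set"
    and meet :: "'a \<Rightarrow> 'a \<Rightarrow> 'a" (infixl "\<sqinter>" 70)
    and zero :: 'a ("\<zero>")
    and one :: 'a ("\<one>")
begin

abbreviation le :: "'a \<Rightarrow> 'a \<Rightarrow> bool" (infix "\<sqsubseteq>" 50) where
  "u \<sqsubseteq> v \<equiv> u = u \<sqinter> v"

end

locale bounded_semilattice = semilattice_signature +
  assumes meet_closed: "\<lbrakk>u \<in> V; v \<in> V\<rbrakk> \<Longrightarrow> u \<sqinter> v \<in> V"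
    and zero_closed: "\<zero> \<in> V"
    and one_closed: "\<one> \<in> V"
    and meet_assoc: "\<lbrakk>u \<in> V; v \<in> V; w \<in> V\<rbrakk> \<Longrightarrow> (u \<sqinter> v) \<sqinter> w = u \<sqinter> (v \<sqinter> w)"
    and meet_commute: "\<lbrakk>u \<in> V; v \<in> V\<rbrakk> \<Longrightarrow> u \<sqinter> v = v \<sqinter> u"
    and meet_idem: "u \<in> V \<Longrightarrow> u \<sqinter> u = u"
    and zero_least: "u \<in> V \<Longrightarrow> \<zero> \<sqsubseteq> u"
    and one_greatest: "u \<in> V \<Longrightarrow> u \<sqsubseteq> \<one>"

locale projectional_semilattice = bounded_semilattice V meet zero one
  for V :: "'a set"
    and meet :: "'a \<Rightarrow> 'a \<Rightarrow> 'a" (infixl "\<sqinter>" 70)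
    and zero :: 'a ("\<zero>")
    and one :: 'a ("\<one>") +
  fixes c :: "'v \<Rightarrow> 'a \<Rightarrow> 'a"
    and d :: "'v \<Rightarrow> 'v \<Rightarrow> 'a"
    and domn :: "'a \<Rightarrow> 'v set"
  assumes c_closed: "u \<in> V \<Longrightarrow> c x u \<in> V"
    and d_closed: "d x y \<in> V"
    and PS1: "c x \<zero> = \<zero>"
    and PS2: "u \<in> V \<Longrightarrow> u \<sqsubseteq> c x u"
    and PS3: "\<lbrakk>u \<in> V; v \<in> V\<rbrakk> \<Longrightarrow> c x (u \<sqinter> c x v) = c x u \<sqinter> c x v"
    and PS4: "u \<in> V \<Longrightarrow> c x (c y u) = c y (c x u)"
    and PS5: "\<lbrakk>u \<in> V; u \<noteq> \<zero>\<rbrakk> \<Longrightarrow> u \<noteq> c x u \<longleftrightarrow> u \<sqsubseteq> d x x"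
    and PS6: "\<lbrakk>x \<noteq> y; x \<noteq> z\<rbrakk> \<Longrightarrow> d y z = c x (d y x \<sqinter> d x z)"
    and PS7: "\<lbrakk>u \<in> V; x \<noteq> y\<rbrakk> \<Longrightarrow> d x y \<sqinter> c x (d x y \<sqinter> u) \<sqsubseteq> u"
    and PS8: "\<lbrakk>u \<in> V; u \<noteq> \<zero>\<rbrakk> \<Longrightarrow> finite (domn u)"
    and PS9: "u \<in> V \<Longrightarrow> domn u = {x. u \<sqsubseteq> d x x}"
    and PS10: "\<lbrakk>u \<in> V; domn u = {}\<rbrakk> \<Longrightarrow> u = \<one>"
    and PS11: "d x x \<noteq> \<zero>"
    and PS12: "d x y = d y x"


text \<open>
  A function \<open>X \<rightarrow> G\<close> is a partial map with domain exactly \<open>X\<close> and values in \<open>G\<close>.  Unlike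
  \<open>PiE\<close>, this makes the sets \<open>tuples G X\<close> pairwise disjoint, so that a nonempty table
  determines its schema; restriction is \<open>|`\<close>, and \<open>Map.empty\<close> is the empty tuple.
\<close>

definition tuples :: "'g set \<Rightarrow> 'v set \<Rightarrow> ('v \<rightharpoonup> 'g) set" where
  "tuples G X = {t. dom t = X \<and> ran t \<subseteq> G}"

definition Tab :: "'g set \<Rightarrow> ('v \<rightharpoonup> 'g) set set" where
  "Tab G = (\<Union>X \<in> {X. finite X}. Pow (tuples G X))"

definition schema :: "'g set \<Rightarrow> ('v \<rightharpoonup> 'g) set \<Rightarrow> 'v set" where
  "schema G T = (if T = {} then UNIV else (THE X. T \<subseteq> tuples G X))"

lemma schema_empty: "schema G {} = UNIV"
  by (simp add: schema_def)

lemma schema_eq: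
  assumes "T \<noteq> {}" and "T \<subseteq> tuples G X"
  shows "schema G T = X"
proof -
  from assms(1) obtain t where t: "t \<in> T" by blast
  with assms(2) have X: "dom t = X" by (auto simp: tuples_def)
  have "(THE X. T \<subseteq> tuples G X) = X"
  proof (rule the_equality)
    show "T \<subseteq> tuples G X" by (fact assms(2))
  next
    fix X' assume "T \<subseteq> tuples G X'"
    with t have "t \<in> tuples G X'" by blast
    with X show "X' = X" by (simp add: tuples_def)
  qed
  with assms(1) show ?thesis by (simp add: schema_def)
qed

definition natural_join ::
    "'g set \<Rightarrow> ('v \<rightharpoonup> 'g) set \<Rightarrow> ('v \<rightharpoonup> 'g) set \<Rightarrow> ('v \<rightharpoonup> 'g) set" where
  "natural_join G T1 T2 =
    (if T1 = {} \<or> T2 = {} then {}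
     else {t \<in> tuples G (schema G T1 \<union> schema G T2).
             t |` schema G T1 \<in> T1 \<and> t |` schema G T2 \<in> T2})"

definition del :: "'g set \<Rightarrow> 'v \<Rightarrow> ('v \<rightharpoonup> 'g) set \<Rightarrow> ('v \<rightharpoonup> 'g) set" where
  "del G x T = {t |` (schema G T - {x}) | t. t \<in> T}"

definition eq_table :: "'g set \<Rightarrow> 'v \<Rightarrow> 'v \<Rightarrow> ('v \<rightharpoonup> 'g) set" where
  "eq_table G x y = {t \<in> tuples G {x, y}. t x = t y}"

text \<open>\<open>A\<close> is the universe of a subalgebra of the full table algebra over \<open>G\<close>.\<close>

locale conjunctive_table_algebra =
  fixes G :: "'g set"
    and A :: "('v \<rightharpoonup> 'g) set set"
  assumes subset_Tab: "A \<subseteq> Tab G"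
    and empty_mem: "{} \<in> A"
    and unit_mem: "{Map.empty} \<in> A"
    and eq_table_mem: "eq_table G x y \<in> A"
    and join_mem: "\<lbrakk>S \<in> A; T \<in> A\<rbrakk> \<Longrightarrow> natural_join G S T \<in> A"
    and del_mem: "T \<in> A \<Longrightarrow> del G x T \<in> A"

end

theory Submission
  imports Defs
begin

text \<open>
  On tables whose schemas are known, every operation has a description without case distinction
  on emptiness: deletion is \<open>t \<mapsto> t(x := None)\<close>, and \<open>S \<sqsubseteq> T\<close> says that \<open>S\<close> is empty or
  the schema of \<open>T\<close> is contained in that of \<open>S\<close> and every tuple of \<open>S\<close> restricts to one of \<open>T\<close>.
  The axioms then become statements about single tuples.
\<close>

section \<open>Restrictions and ranges of partial maps\<close>

lemma tuplesD:
  assumes "T \<subseteq> tuples G X" "t \<in> T"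
  shows "dom t = X" "ran t \<subseteq> G"
  using assms by (auto simp: tuples_def)

lemma restrict_dom_id: "dom t \<subseteq> X \<Longrightarrow> t |` X = t"
  by (rule ext) (metis domIff in_mono restrict_in restrict_out)

text \<open>Each value of \<open>t\<close> is visible in one of the two restrictions. This lets the
  range condition disappear from the description of joins.\<close>

lemma ran_subset_of_restrict_Un:
  assumes "dom t \<subseteq> X \<union> Y" "ran (t |` X) \<subseteq> G" "ran (t |` Y) \<subseteq> G"
  shows "ran t \<subseteq> G"
proof
  fix g assume "g \<in> ran t"
  then obtain z where z: "t z = Some g" by (auto simp: ran_def)
  with assms(1) have "z \<in> X \<or> z \<in> Y" by blast
  with z have "g \<in> ran (t |` X) \<or> g \<in> ran (t |` Y)"
    by (auto simp: ran_def restrict_map_def)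
  with assms show "g \<in> G" by blast
qed

section \<open>Joins, deletions and equality tables over known schemas\<close>

text \<open>The two restrictions already force the values of \<open>t\<close> into \<open>G\<close>.
  If a table is empty, both sides are empty, so any \<open>X\<close> and \<open>Y\<close> containing
  the tables will do.\<close>

lemma natural_join_eq:
  assumes S: "S \<subseteq> tuples G X" and T: "T \<subseteq> tuples G Y"
  shows "natural_join G S T = {t. dom t = X \<union> Y \<and> t |` X \<in> S \<and> t |` Y \<in> T}"
proof (cases "S = {} \<or> T = {}")
  case True
  then show ?thesis by (auto simp: natural_join_def)
next
  case False
  then have eqs: "schema G S = X" "schema G T = Y"
    using S T by (simp_all add: schema_eq)
  have "t \<in> tuples G (X \<union> Y)" if "dom t = X \<union> Y" "t |` X \<in> S" "t |` Y \<in> T" for t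
    using that ran_subset_of_restrict_Un[of t X Y G] tuplesD(2)[OF S] tuplesD(2)[OF T]
    by (simp add: tuples_def)
  then show ?thesis
    using False by (auto simp: natural_join_def eqs) (auto simp: tuples_def)
qed

lemma natural_join_subset_tuples:
  assumes S: "S \<subseteq> tuples G X" and T: "T \<subseteq> tuples G Y"
  shows "natural_join G S T \<subseteq> tuples G (X \<union> Y)"
proof
  fix t assume "t \<in> natural_join G S T"
  then have "dom t = X \<union> Y" "t |` X \<in> S" "t |` Y \<in> T" by (simp_all add: natural_join_eq[OF S T])
  then show "t \<in> tuples G (X \<union> Y)"
    using ran_subset_of_restrict_Un[of t X Y G] tuplesD(2)[OF S] tuplesD(2)[OF T]
    by (simp add: tuples_def)
qed

text \<open>Tuples of \<open>T\<close> have domain exactly \<open>X\<close>, so restricting to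
  \<open>X - {x}\<close> only erases \<open>x\<close>. For empty \<open>T\<close> the conventional
  schema \<open>UNIV\<close> is harmless, as both sides are empty.\<close>

lemma del_eq:
  assumes T: "T \<subseteq> tuples G X"
  shows "del G x T = (\<lambda>t. t(x := None)) ` T"
proof (cases "T = {}")
  case True
  then show ?thesis by (simp add: del_def)
next
  case False
  with T have X: "schema G T = X" by (simp add: schema_eq)
  have "t |` (X - {x}) = t(x := None)" if "t \<in> T" for t
    using tuplesD(1)[OF T that] by (intro ext) (auto simp: restrict_map_def)
  then show ?thesis by (force simp: del_def X)
qed

lemma del_subset_tuples:
  assumes T: "T \<subseteq> tuples G X"
  shows "del G x T \<subseteq> tuples G (X - {x})"
proof -
  have "t(x := None) \<in> tuples G (X - {x})" if "t \<in> T" for t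
    using tuplesD[OF T that] by (auto simp: tuples_def ran_def split: if_splits)
  then show ?thesis by (auto simp: del_eq[OF T])
qed

lemma eq_table_subset_tuples: "eq_table G x y \<subseteq> tuples G {x, y}"
  by (auto simp: eq_table_def)

lemma eq_table_commute: "eq_table G x y = eq_table G y x"
  by (auto simp: eq_table_def insert_commute)

text \<open>A constant tuple witnesses this. Over an empty \<open>G\<close> no tuple has the
  nonempty domain \<open>{x, y}\<close>, so PS11 would fail.\<close>

lemma eq_table_nonempty:
  assumes "G \<noteq> {}"
  shows "eq_table G x y \<noteq> {}"
proof -
  from assms obtain g where "g \<in> G" by blast
  then have "[x \<mapsto> g, y \<mapsto> g] \<in> eq_table G x y"
    by (auto simp: eq_table_def tuples_def ran_def split: if_splits)
  then show ?thesis by blast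
qed

section \<open>The semilattice order on tables\<close>

text \<open>Tuples of the join have domain \<open>X \<union> Y\<close> and those of a nonempty
  \<open>S\<close> have domain \<open>X\<close>, whence \<open>Y \<subseteq> X\<close>. Empty
  \<open>S\<close> needs its own disjunct because \<open>X\<close> is then arbitrary.\<close>

lemma le_iff:
  assumes S: "S \<subseteq> tuples G X" and T: "T \<subseteq> tuples G Y"
  shows "S = natural_join G S T \<longleftrightarrow> S = {} \<or> Y \<subseteq> X \<and> (\<forall>s\<in>S. s |` Y \<in> T)"
proof
  assume le: "S = natural_join G S T"
  have "Y \<subseteq> X \<and> s |` Y \<in> T" if "s \<in> S" for s
  proof -
    have "s \<in> natural_join G S T" using le that by simp
    then have "dom s = X \<union> Y" "s |` Y \<in> T" by (simp_all add: natural_join_eq[OF S T])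
    with tuplesD(1)[OF S that] show ?thesis by blast
  qed
  then show "S = {} \<or> Y \<subseteq> X \<and> (\<forall>s\<in>S. s |` Y \<in> T)" by blast
next
  assume *: "S = {} \<or> Y \<subseteq> X \<and> (\<forall>s\<in>S. s |` Y \<in> T)"
  show "S = natural_join G S T"
  proof (cases "S = {}")
    case True
    then show ?thesis by (simp add: natural_join_def)
  next
    case False
    with * have Y: "Y \<subseteq> X" "\<forall>s\<in>S. s |` Y \<in> T" by auto
    then have "natural_join G S T = {s. dom s = X \<and> s |` X \<in> S \<and> s |` Y \<in> T}"
      by (simp add: natural_join_eq[OF S T] sup.absorb1)
    also have "\<dots> = S"
    proof (intro equalityI subsetI)
      fix s assume "s \<in> {s. dom s = X \<and> s |` X \<in> S \<and> s |` Y \<in> T}"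
      then show "s \<in> S" using restrict_dom_id[of s X] by simp
    next
      fix s assume s: "s \<in> S"
      then have "dom s = X" by (rule tuplesD(1)[OF S])
      with s Y show "s \<in> {s. dom s = X \<and> s |` X \<in> S \<and> s |` Y \<in> T}"
        using restrict_dom_id[of s X] by simp
    qed
    finally show ?thesis by (rule sym)
  qed
qed

text \<open>The condition \<open>t x = t x\<close> is vacuous, so \<open>eq_table G x x\<close>
  contains every tuple over \<open>{x}\<close> and only the inclusion of schemas matters.\<close>

lemma le_eq_table_refl_iff:
  assumes T: "T \<subseteq> tuples G X" and "T \<noteq> {}"
  shows "T = natural_join G T (eq_table G x x) \<longleftrightarrow> x \<in> X"
proof -
  have "s |` {x} \<in> eq_table G x x" if "x \<in> X" "s \<in> T" for s
    using tuplesD[OF T that(2)] that(1)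
    by (auto simp: eq_table_def tuples_def ran_def restrict_map_def split: if_splits)
  then show ?thesis
    using \<open>T \<noteq> {}\<close> by (auto simp: le_iff[OF T eq_table_subset_tuples])
qed

section \<open>Semilattice laws\<close>

text \<open>Nested restrictions collapse by absorption, so both sides consist of the maps on
  \<open>X \<union> Y \<union> Z\<close> whose three restrictions lie in \<open>S\<close>,
  \<open>T\<close> and \<open>U\<close>.\<close>

lemma natural_join_assoc:
  assumes S: "S \<subseteq> tuples G X" and T: "T \<subseteq> tuples G Y" and U: "U \<subseteq> tuples G Z"
  shows "natural_join G (natural_join G S T) U = natural_join G S (natural_join G T U)"
proof -
  have "(X \<union> Y) \<inter> X = X" "(X \<union> Y) \<inter> Y = Y" "(Y \<union> Z) \<inter> Y = Y" "(Y \<union> Z) \<inter> Z = Z"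
    by auto
  then show ?thesis
    unfolding natural_join_eq[OF natural_join_subset_tuples[OF S T] U]
      natural_join_eq[OF S natural_join_subset_tuples[OF T U]]
    unfolding natural_join_eq[OF S T] natural_join_eq[OF T U]
    by auto
qed

lemma natural_join_commute:
  assumes S: "S \<subseteq> tuples G X" and T: "T \<subseteq> tuples G Y"
  shows "natural_join G S T = natural_join G T S"
  by (auto simp: natural_join_eq[OF S T] natural_join_eq[OF T S])

lemma le_refl:
  assumes S: "S \<subseteq> tuples G X"
  shows "S = natural_join G S S"
  using tuplesD(1)[OF S] by (auto simp: le_iff[OF S S] restrict_dom_id)

lemma le_unit:
  assumes S: "S \<subseteq> tuples G X"
  shows "S = natural_join G S {Map.empty}"
proof -
  have "{Map.empty} \<subseteq> tuples G {}" by (simp add: tuples_def)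
  then show ?thesis by (subst le_iff[OF S]) auto
qed

section \<open>Deletion as a cylindrification\<close>

lemma le_del:
  assumes S: "S \<subseteq> tuples G X"
  shows "S = natural_join G S (del G x S)"
proof -
  have "s |` (X - {x}) = s(x := None)" if "s \<in> S" for s
    using tuplesD(1)[OF S that] by (intro ext) (auto simp: restrict_map_def)
  then show ?thesis
    unfolding le_iff[OF S del_subset_tuples[OF S]] by (auto simp: del_eq[OF S])
qed

text \<open>This is PS3. Erasing \<open>x\<close> is compatible with both restrictions. Conversely,
  a tuple on the right can be given the \<open>x\<close>-entry of a tuple of \<open>S\<close>, since
  the other table does not see \<open>x\<close>.\<close>

lemma del_natural_join_del:
  assumes S: "S \<subseteq> tuples G X" and T: "T \<subseteq> tuples G Y"
  shows "del G x (natural_join G S (del G x T)) = natural_join G (del G x S) (del G x T)"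
    (is "?L = ?R")
proof -
  note T' = del_subset_tuples[OF T, of x] and S' = del_subset_tuples[OF S, of x]
  have L: "?L = (\<lambda>t. t(x := None)) `
      {t. dom t = X \<union> (Y - {x}) \<and> t |` X \<in> S \<and> t |` (Y - {x}) \<in> del G x T}"
    unfolding del_eq[OF natural_join_subset_tuples[OF S T']]
    unfolding natural_join_eq[OF S T'] ..
  have R: "?R = {t. dom t = (X - {x}) \<union> (Y - {x}) \<and> t |` (X - {x}) \<in> del G x S
      \<and> t |` (Y - {x}) \<in> del G x T}"
    by (rule natural_join_eq[OF S' T'])
  show ?thesis
  proof (intro equalityI subsetI)
    fix t assume "t \<in> ?L"
    then obtain s where s: "t = s(x := None)" "dom s = X \<union> (Y - {x})" "s |` X \<in> S"
        "s |` (Y - {x}) \<in> del G x T"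
      unfolding L by blast
    have "t |` (X - {x}) = (s |` X)(x := None)" "t |` (Y - {x}) = s |` (Y - {x})"
      by (auto simp: s(1) restrict_map_def)
    moreover have "(s |` X)(x := None) \<in> del G x S"
      unfolding del_eq[OF S] using s(3) by (rule imageI)
    moreover have "dom t = (X - {x}) \<union> (Y - {x})" using s(1,2) by auto
    ultimately show "t \<in> ?R" unfolding R using s(4) by simp
  next
    fix t assume "t \<in> ?R"
    then have t: "dom t = (X - {x}) \<union> (Y - {x})" "t |` (X - {x}) \<in> del G x S"
        "t |` (Y - {x}) \<in> del G x T"
      unfolding R by simp_all
    from t(2) obtain r where r: "r \<in> S" "t |` (X - {x}) = r(x := None)"
      by (auto simp: del_eq[OF S])
    have X: "dom r = X" by (rule tuplesD(1)[OF S r(1)])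
    \<comment> \<open>The entry at \<open>x\<close> is restored from \<open>r\<close>. If
      \<open>x\<close> is not in \<open>X\<close>, then \<open>r x\<close> is \<open>None\<close>
      and nothing is added.\<close>
    let ?s = "t(x := r x)"
    have "?s |` X = r"
    proof
      fix z
      show "(?s |` X) z = r z"
        using fun_cong[OF r(2), of z] X by (auto simp: restrict_map_def split: if_splits)
    qed
    moreover have "?s |` (Y - {x}) = t |` (Y - {x})" by (auto simp: restrict_map_def)
    moreover have "dom ?s = X \<union> (Y - {x})" using t(1) X by (auto split: if_splits)
    moreover have "t = ?s(x := None)"
    proof -
      have "x \<notin> dom t" using t(1) by simp
      then show ?thesis by auto
    qed
    ultimately show "t \<in> ?L" unfolding L using r(1) t(3) by (intro image_eqI[where x = ?s]) auto
  qed
qed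

lemma del_commute:
  assumes T: "T \<subseteq> tuples G X"
  shows "del G x (del G y T) = del G y (del G x T)"
  unfolding del_eq[OF del_subset_tuples[OF T]] unfolding del_eq[OF T]
  by (cases "x = y") (simp_all add: image_image fun_upd_twist)

text \<open>Erasing an absent variable changes nothing. Erasing a present one changes the schema,
  which a nonempty table determines uniquely.\<close>

lemma del_neq_iff:
  assumes T: "T \<subseteq> tuples G X" and "T \<noteq> {}"
  shows "T \<noteq> del G x T \<longleftrightarrow> x \<in> X"
proof
  assume "T \<noteq> del G x T"
  moreover have "t(x := None) = t" if "x \<notin> X" "t \<in> T" for t
    using tuplesD(1)[OF T that(2)] that(1) by auto
  ultimately show "x \<in> X" by (force simp: del_eq[OF T])
next
  assume x: "x \<in> X"
  show "T \<noteq> del G x T"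
  proof
    assume "T = del G x T"
    with del_subset_tuples[OF T, of x] have "schema G T = X - {x}"
      using schema_eq[OF \<open>T \<noteq> {}\<close>] by simp
    with schema_eq[OF \<open>T \<noteq> {}\<close> T] x show False by blast
  qed
qed

section \<open>Axioms for equality tables\<close>

text \<open>The join links \<open>y\<close> and \<open>z\<close> through the intermediate variable
  \<open>x\<close>. Being different from both, \<open>x\<close> can be erased or reinserted with
  their common value.\<close>

lemma eq_table_trans:
  assumes "x \<noteq> y" "x \<noteq> z"
  shows "eq_table G y z = del G x (natural_join G (eq_table G y x) (eq_table G x z))" (is "_ = ?R")
proof -
  note yx = eq_table_subset_tuples[of G y x] and xz = eq_table_subset_tuples[of G x z]
  note J = natural_join_subset_tuples[OF yx xz]
  have R: "?R = (\<lambda>t. t(x := None)) ` {t \<in> tuples G {x, y, z}. t y = t x \<and> t x = t z}"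
  proof -
    have "natural_join G (eq_table G y x) (eq_table G x z)
        = {t \<in> tuples G {x, y, z}. t y = t x \<and> t x = t z}"
      (is "?J = ?K")
    proof (intro equalityI subsetI)
      fix t assume t: "t \<in> ?J"
      have "{y, x} \<union> {x, z} = {x, y, z}" by auto
      then have "t \<in> tuples G {x, y, z}" using J t by auto
      moreover have "t |` {y, x} \<in> eq_table G y x" "t |` {x, z} \<in> eq_table G x z"
        using t by (simp_all add: natural_join_eq[OF yx xz])
      ultimately show "t \<in> ?K" by (simp add: eq_table_def)
    next
      fix t assume "t \<in> ?K"
      then have t: "dom t = {x, y, z}" "ran t \<subseteq> G" "t y = t x" "t x = t z"
        by (auto simp: tuples_def)
      have "ran (t |` Z) \<subseteq> G" for Z
        using t(2) by (auto simp: ran_def restrict_map_def split: if_splits)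
      then show "t \<in> ?J"
        unfolding natural_join_eq[OF yx xz] using t by (auto simp: eq_table_def tuples_def)
    qed
    then show ?thesis unfolding del_eq[OF J] by (rule arg_cong)
  qed
  show ?thesis
  proof (intro equalityI subsetI)
    fix t assume t: "t \<in> eq_table G y z"
    then have d: "dom t = {y, z}" "ran t \<subseteq> G" "t y = t z"
      by (auto simp: eq_table_def tuples_def)
    \<comment> \<open>The common value of \<open>y\<close> and \<open>z\<close> is the only possible
      entry at \<open>x\<close>. It is not \<open>None\<close>, so the domain becomes
      \<open>{x, y, z}\<close>.\<close>
    let ?s = "t(x := t y)"
    have "y \<in> dom t" using d(1) by simp
    then have "dom ?s = {x, y, z}" using d(1) by auto
    moreover have "ran ?s \<subseteq> G" using d(2) by (auto simp: ran_def split: if_splits)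
    moreover have "t = ?s(x := None)"
    proof -
      have "x \<notin> dom t" using d(1) assms by simp
      then show ?thesis by auto
    qed
    ultimately show "t \<in> ?R" unfolding R using assms d(3)
      by (intro image_eqI[where x = ?s]) (auto simp: tuples_def)
  next
    fix t assume "t \<in> ?R"
    then obtain s where "t = s(x := None)" "dom s = {x, y, z}" "ran s \<subseteq> G" "s y = s x" "s x = s z"
      unfolding R by (auto simp: tuples_def)
    with assms show "t \<in> eq_table G y z"
      by (auto simp: eq_table_def tuples_def ran_def split: if_splits)
  qed
qed

text \<open>This is PS7. Deletion forgets the entry at \<open>x\<close> but keeps the one at
  \<open>y\<close>, and the outer join with \<open>E\<close> recovers the former from the
  latter.\<close>

lemma eq_table_join_del_le:
  assumes S: "S \<subseteq> tuples G X" and "x \<noteq> y"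
  defines "E \<equiv> eq_table G x y"
  defines "L \<equiv> natural_join G E (del G x (natural_join G E S))"
  shows "L = natural_join G L S"
proof -
  have E: "E \<subseteq> tuples G {x, y}" unfolding E_def by (rule eq_table_subset_tuples)
  note J = natural_join_subset_tuples[OF E S]
  note D = del_subset_tuples[OF J, of x]
  have L: "L \<subseteq> tuples G ({x, y} \<union> ({x, y} \<union> X - {x}))"
    unfolding L_def by (rule natural_join_subset_tuples[OF E D])
  have "t |` X \<in> S" if "t \<in> L" for t
  proof -
    from that have tE: "t |` {x, y} \<in> E"
      and tD: "t |` ({x, y} \<union> X - {x}) \<in> del G x (natural_join G E S)"
      and dt: "dom t = {x, y} \<union> ({x, y} \<union> X - {x})"
      unfolding L_def by (simp_all add: natural_join_eq[OF E D])
    from tD obtain s where s: "s |` {x, y} \<in> E" "s |` X \<in> S" "dom s = {x, y} \<union> X"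
        "t |` ({x, y} \<union> X - {x}) = s(x := None)"
      unfolding del_eq[OF J] unfolding natural_join_eq[OF E S] by blast
    have ts: "t z = s z" if "z \<noteq> x" "z \<in> {x, y} \<union> X" for z
      using fun_cong[OF s(4), of z] that by (simp add: restrict_map_def split: if_splits)
    \<comment> \<open>Membership in \<open>E\<close> gives \<open>t x = t y\<close> and
      \<open>s x = s y\<close>, and \<open>t\<close> and \<open>s\<close> agree at
      \<open>y\<close>.\<close>
    moreover have "t x = s x"
      using tE s(1) ts[of y] \<open>x \<noteq> y\<close> by (simp add: E_def eq_table_def restrict_map_def)
    ultimately have "t z = s z" if "z \<in> X" for z using that by (cases "z = x") auto
    then have "t |` X = s |` X" by (auto simp: restrict_map_def)
    with s(2) show ?thesis by simp
  qed
  then show ?thesis by (subst le_iff[OF L S]) auto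
qed

section \<open>The schema as the domain function\<close>

text \<open>For empty \<open>T\<close> both sides are \<open>UNIV\<close>: the left by convention,
  the right because the empty table is below every table.\<close>

lemma schema_eq_le_eq_table:
  assumes T: "T \<subseteq> tuples G X"
  shows "schema G T = {x. T = natural_join G T (eq_table G x x)}"
proof (cases "T = {}")
  case True
  then show ?thesis by (simp add: schema_def natural_join_def)
next
  case False
  with T show ?thesis by (simp add: le_eq_table_refl_iff schema_eq)
qed

text \<open>The convention \<open>schema G {} = UNIV\<close> rules out the empty table, and the only
  tuple with empty domain is \<open>Map.empty\<close>.\<close>

lemma schema_empty_imp_unit:
  assumes T: "T \<subseteq> tuples G X" and "schema G T = {}"
  shows "T = {Map.empty}"
proof -
  have ne: "T \<noteq> {}" using assms(2) by (auto simp: schema_empty)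
  with assms have "X = {}" by (simp add: schema_eq)
  with T have "T \<subseteq> {Map.empty}" by (auto simp: tuples_def)
  with ne show ?thesis by blast
qed

theorem theorem1:
  fixes G :: "'g set"
    and A :: "('v \<rightharpoonup> 'g) set set"
  assumes "countable (UNIV :: 'v set)"
    and "infinite (UNIV :: 'v set)"
    and "G \<noteq> {}"
    and "conjunctive_table_algebra G A"
  shows "projectional_semilattice A (natural_join G) {} {Map.empty}
           (del G) (eq_table G) (schema G)"
proof -
  interpret conjunctive_table_algebra G A by (fact assms(4))
  \<comment> \<open>Each member of \<open>A\<close> gets a schema witness, reducing the axioms to
    the lemmas on tables. Finiteness serves only PS8.\<close>
  have tab: "\<exists>X. finite X \<and> T \<subseteq> tuples G X" if "T \<in> A" for T
    using that subset_Tab by (auto simp: Tab_def)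
  show ?thesis
  proof
    fix S T U :: "('v \<rightharpoonup> 'g) set" and x y :: 'v
    assume "S \<in> A"
    with tab obtain X where S: "finite X" "S \<subseteq> tuples G X" by blast
    show "{} = natural_join G {} S" by (simp add: natural_join_def)
    show "natural_join G S S = S" using le_refl[OF S(2)] by simp
    show "S = natural_join G S {Map.empty}" by (rule le_unit[OF S(2)])
    show "S = natural_join G S (del G x S)" by (rule le_del[OF S(2)])
    show "del G x (del G y S) = del G y (del G x S)" by (rule del_commute[OF S(2)])
    show "S \<noteq> del G x S \<longleftrightarrow> S = natural_join G S (eq_table G x x)" if "S \<noteq> {}"
      using del_neq_iff[OF S(2) that] le_eq_table_refl_iff[OF S(2) that] by simp
    show "natural_join G (eq_table G x y) (del G x (natural_join G (eq_table G x y) S))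
        = natural_join G (natural_join G (eq_table G x y)
            (del G x (natural_join G (eq_table G x y) S))) S" if "x \<noteq> y"
      by (rule eq_table_join_del_le[OF S(2) that])
    show "finite (schema G S)" if "S \<noteq> {}"
      using schema_eq[OF that S(2)] S(1) by simp
    show "schema G S = {x. S = natural_join G S (eq_table G x x)}"
      by (rule schema_eq_le_eq_table[OF S(2)])
    show "S = {Map.empty}" if "schema G S = {}"
      by (rule schema_empty_imp_unit[OF S(2) that])
    assume "T \<in> A"
    with tab obtain Y where T: "T \<subseteq> tuples G Y" by blast
    show "natural_join G S T = natural_join G T S" by (rule natural_join_commute[OF S(2) T])
    show "del G x (natural_join G S (del G x T)) = natural_join G (del G x S) (del G x T)"
      by (rule del_natural_join_del[OF S(2) T])
    assume "U \<in> A"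
    with tab obtain Z where "U \<subseteq> tuples G Z" by blast
    with S(2) T
    show "natural_join G (natural_join G S T) U = natural_join G S (natural_join G T U)"
      by (rule natural_join_assoc)
  next
    fix x y z :: 'v
    show "del G x {} = {}" by (simp add: del_def)
    show "eq_table G x y = eq_table G y x" by (rule eq_table_commute)
    show "eq_table G x x \<noteq> {}" by (rule eq_table_nonempty[OF assms(3)])
    show "eq_table G y z = del G x (natural_join G (eq_table G y x) (eq_table G x z))"
      if "x \<noteq> y" "x \<noteq> z"
      by (rule eq_table_trans[OF that])
  \<comment> \<open>The remaining goals are the closure conditions, which are exactly those of a
    subalgebra.\<close>
  qed (fact empty_mem unit_mem eq_table_mem join_mem del_mem)+
qed

end
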